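(* Let $K$ be a finite simplicial complex, $p\ge0$ a homology degree, $\mathcal{M}$ a smooth finite-dimensional manifold without boundary, and $F:\mathcal{M}\to\mathbb{R}^K$ a continuous map all of whose values are filter functions, of class $C^1$ on some open set $U\subseteq\mathcal{M}$; let $B_p:=\mathrm{Dgm}_p\circ F:\mathcal{M}\to Bar$. Let \[ \tilde{\mathcal{M}}:=\{\theta\in\mathcal{M}\mid \exists\text{ an open neighborhood }U_\theta\text{ of }\theta\text{ such that }F(\theta')\sim F(\theta)\text{ for all }\theta'\in U_\theta\}. \] Given $\theta\in U\cap\tilde{\mathcal{M}}$ and a barcode template $(P_p,U_p)$ of $F(\theta)$, for any choice of ordering $(\sigma_1,\sigma_1'),\dots,(\sigma_m,\sigma_m'),\tau_1,\dots,\tau_n$ of $(P_p,U_p)$ (the pairs being the elements of $P_p$ and the $\tau_j$ the elements of $U_p$), the map \[ \tilde B_p:\theta'\mapsto\Big[\big(F(\theta')(\sigma_i),F(\theta')(\sigma_i')\big)_{i=1}^m,\big(F(\theta')(\tau_j)\big)_{j=1}^n\Big]\in\mathbb{R}^{2m}\times\mathbb{R}^n \] is a local $C^1$ lift of $B_p$ around $\theta$, and the corresponding differential of $B_p$ at $\theta$ is \[ d_{\theta,\tilde B_p}B_p(\cdot)=\Big[\big(d_\theta F(\cdot)(\sigma_i),d_\theta F(\cdot)(\sigma_i')\big)_{i=1}^m,\big(d_\theta F(\cdot)(\tau_j)\big)_{j=1}^n\Big]. \]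
   Context: Barcodes: a barcode is a multiset $D=D'\cup\Delta^\infty$, where $D'$ is a finite multiset of elements of $\mathbb{R}\times(\mathbb{R}\cup\{+\infty\})$ and $\Delta^\infty$ consists of the diagonal $\Delta=\{(b,b)\mid b\in\mathbb{R}\}$ with countably infinite multiplicity. $Bar$ is the set of barcodes. For $m,n\in\mathbb{N}$, $Q_{m,n}:\mathbb{R}^{2m}\times\mathbb{R}^n\to Bar$ is $Q_{m,n}(b_1,d_1,\dots,b_m,d_m,v_1,\dots,v_n)=\{(b_i,d_i)\}_{i=1}^m\cup\{(v_j,+\infty)\}_{j=1}^n\cup\Delta^\infty$. A local $C^1$ lift of $B:\mathcal{M}\to Bar$ around $\theta$ is a $C^1$ map $\tilde B:W\to\mathbb{R}^{2m}\times\mathbb{R}^n$ on an open neighborhood $W$ of $\theta$ with $B=Q_{m,n}\circ\tilde B$ on $W$; the corresponding differential of $B$ at $\theta$ is $d_{\theta,\tilde B}B:=d_\theta\tilde B:T_\theta\mathcal{M}\to\mathbb{R}^{2m}\times\mathbb{R}^n$. Filter functions: $f:K\to\mathbb{R}$ is a filter function if $f(\sigma)\le f(\sigma')$ whenever $\sigma\subseteq\sigma'$ are simplices of $K$. $\mathrm{Dgm}_p(f)\in Bar$ denotes the degree-$p$ barcode of $f$: with $K^t=\{\sigma\in K\mid f(\sigma)\le t\}$ and homology over a fixed field, the persistence module $(H_p(K^t))_{t\in\mathbb{R}}$ with maps induced by inclusions is isomorphic to a finite direct sum of interval modules $\bigoplus_{J\in\mathcal{J}}\mathbb{I}_J$,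 and $\mathrm{Dgm}_p(f)=\{(\inf J,\sup J)\}_{J\in\mathcal{J}}\cup\Delta^\infty$. Ordering equivalence: $f\sim g$ if for all $\sigma,\sigma'\in K$, $f(\sigma)\le f(\sigma')\iff g(\sigma)\le g(\sigma')$. Barcode template: a barcode template of a filter function $f$ (in degree $p$) is a pair $(P_p,U_p)$, where $P_p$ is a (finite) multiset of pairs of simplices of $K$ and $U_p$ a (finite) multiset of simplices of $K$, such that $\mathrm{Dgm}_p(f)=\{(f(\sigma),f(\sigma'))\}_{(\sigma,\sigma')\in P_p}\cup\{(f(\sigma),+\infty)\}_{\sigma\in U_p}\cup\Delta^\infty$. *)

theory Defs
  imports "HOL-Analysis.Analysis" "HOL-Analysis.Finite_Function_Topology" "HOL-Library.Multiset" "HOL-Library.Extended_Nat"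
begin

section \<open>Barcodes\<close>

text \<open>A multiset that may contain points infinitely often is given by its multiplicity function.
  The second coordinate of a point ranges over \<open>\<real> \<union> {+\<infinity>}\<close>, so \<open>-\<infinity>\<close> is excluded in \<open>Bar\<close>.\<close>

type_synonym barcode = "real \<times> ereal \<Rightarrow> enat"

definition with_diagonal :: "(real \<times> ereal) multiset \<Rightarrow> barcode" where
  "with_diagonal D = (\<lambda>x. enat (count D x) + (if snd x = ereal (fst x) then \<infinity> else 0))"

definition Bar :: "barcode set" where
  "Bar = {with_diagonal D | D. \<forall>x \<in># D. snd x \<noteq> -\<infinity>}"

text \<open>\<open>\<real>\<^sup>I\<close> for a finite index set \<open>I\<close> is realised as a subspace of the normed space of finitely
  supported functions; \<open>\<real>\<^sup>m\<close> is \<open>coord_space {..<m}\<close>.\<close>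

definition coord_space :: "'i set \<Rightarrow> ('i \<Rightarrow>\<^sub>0 real) set" where
  "coord_space I = {x. Poly_Mapping.keys x \<subseteq> I}"

definition Qmap :: "nat \<Rightarrow> nat \<Rightarrow> (nat \<Rightarrow>\<^sub>0 real) \<times> (nat \<Rightarrow>\<^sub>0 real) \<Rightarrow> barcode" where
  "Qmap m n z = with_diagonal
     (mset (map (\<lambda>i. (Poly_Mapping.lookup (fst z) (2 * i),
                      ereal (Poly_Mapping.lookup (fst z) (2 * i + 1)))) [0..<m])
      + mset (map (\<lambda>j. (Poly_Mapping.lookup (snd z) j, \<infinity>)) [0..<n]))"


section \<open>Simplicial homology over a field\<close>

definition abstract_simplicial_complex :: "'a set set \<Rightarrow> bool" where
  "abstract_simplicial_complex K \<longleftrightarrow>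
     (\<forall>\<sigma>\<in>K. finite \<sigma> \<and> \<sigma> \<noteq> {}) \<and> (\<forall>\<sigma>\<in>K. \<forall>\<tau>\<subseteq>\<sigma>. \<tau> \<noteq> {} \<longrightarrow> \<tau> \<in> K)"

text \<open>Oriented \<open>p\<close>-chains: alternating functions on the orderings \<open>[v\<^sub>0, \<dots>, v\<^sub>p]\<close> of the \<open>p\<close>-simplices,
  the value being the coefficient of the oriented simplex. No order on the vertices is needed.\<close>

type_synonym ('a, 'k) chain = "'a list \<Rightarrow> 'k"

definition chains :: "'a set set \<Rightarrow> nat \<Rightarrow> ('a, 'k::field) chain set" where
  "chains L p = {c.
     (\<forall>xs. c xs \<noteq> 0 \<longrightarrow> distinct xs \<and> length xs = p + 1 \<and> set xs \<in> L) \<and>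
     (\<forall>xs i j. i < j \<and> j < length xs \<longrightarrow> c (xs[i := xs ! j, j := xs ! i]) = - c xs)}"

text \<open>The coefficient of \<open>[y\<^sub>1, \<dots>, y\<^sub>p]\<close> in \<open>\<partial>[v, y\<^sub>1, \<dots>, y\<^sub>p]\<close> is \<open>1\<close>; by alternation this determines
  the usual boundary \<open>\<partial>[v\<^sub>0, \<dots>, v\<^sub>p] = \<Sum>\<^sub>i (-1)\<^sup>i [v\<^sub>0, \<dots>, v\<^sub>i\<^sub>-\<^sub>1, v\<^sub>i\<^sub>+\<^sub>1, \<dots>, v\<^sub>p]\<close>.
  The empty list gets \<open>0\<close>, i.e. homology is not reduced.\<close>

definition boundary :: "('a, 'k::field) chain \<Rightarrow> ('a, 'k) chain" where
  "boundary c = (\<lambda>ys. if ys = [] then 0 else (\<Sum>v | c (v # ys) \<noteq> 0. c (v # ys)))"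

definition cycles :: "'a set set \<Rightarrow> nat \<Rightarrow> ('a, 'k::field) chain set" where
  "cycles L p = {c \<in> chains L p. boundary c = (\<lambda>_. 0)}"

definition boundaries :: "'a set set \<Rightarrow> nat \<Rightarrow> ('a, 'k::field) chain set" where
  "boundaries L p = boundary ` chains L (p + 1)"

definition homologous :: "'a set set \<Rightarrow> nat \<Rightarrow> (('a, 'k::field) chain \<times> ('a, 'k) chain) set" where
  "homologous L p =
     {(c, c'). c \<in> cycles L p \<and> c' \<in> cycles L p \<and> (\<lambda>xs. c xs - c' xs) \<in> boundaries L p}"

definition homology :: "'a set set \<Rightarrow> nat \<Rightarrow> ('a, 'k::field) chain set set" where
  "homology L p = cycles L p // homologous L p"


section \<open>Persistence modules and diagrams\<close>

text \<open>For \<open>s \<le> t\<close>, \<open>pm_trans s t\<close> is the structure map from the space at \<open>s\<close> to the space at \<open>t\<close>.\<close>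

record ('k, 'v) persistence_module =
  pm_space :: "real \<Rightarrow> 'v set"
  pm_plus :: "real \<Rightarrow> 'v \<Rightarrow> 'v \<Rightarrow> 'v"
  pm_scale :: "real \<Rightarrow> 'k \<Rightarrow> 'v \<Rightarrow> 'v"
  pm_trans :: "real \<Rightarrow> real \<Rightarrow> 'v \<Rightarrow> 'v"

definition pm_isomorphic ::
  "('k, 'v) persistence_module \<Rightarrow> ('k, 'w) persistence_module \<Rightarrow> bool" where
  "pm_isomorphic V W \<longleftrightarrow> (\<exists>\<Phi>.
     (\<forall>t. bij_betw (\<Phi> t) (pm_space V t) (pm_space W t)) \<and>
     (\<forall>t. \<forall>x\<in>pm_space V t. \<forall>y\<in>pm_space V t.
        \<Phi> t (pm_plus V t x y) = pm_plus W t (\<Phi> t x) (\<Phi> t y)) \<and>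
     (\<forall>t a. \<forall>x\<in>pm_space V t. \<Phi> t (pm_scale V t a x) = pm_scale W t a (\<Phi> t x)) \<and>
     (\<forall>s t. s \<le> t \<longrightarrow> (\<forall>x\<in>pm_space V s. \<Phi> t (pm_trans V s t x) = pm_trans W s t (\<Phi> s x))))"

definition interval_module :: "real set \<Rightarrow> ('k::field, 'k) persistence_module" where
  "interval_module J = \<lparr>
     pm_space = (\<lambda>t. if t \<in> J then UNIV else {0}),
     pm_plus = (\<lambda>t x y. x + y),
     pm_scale = (\<lambda>t a x. a * x),
     pm_trans = (\<lambda>s t x. if s \<in> J \<and> t \<in> J then x else 0)\<rparr>"

text \<open>For a finite index set, the direct sum is the product.\<close>

definition pm_sum ::
  "'i set \<Rightarrow> ('i \<Rightarrow> ('k, 'v) persistence_module) \<Rightarrow> ('k, 'i \<Rightarrow> 'v) persistence_module" where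
  "pm_sum I V = \<lparr>
     pm_space = (\<lambda>t. \<Pi>\<^sub>E i\<in>I. pm_space (V i) t),
     pm_plus = (\<lambda>t x y. \<lambda>i\<in>I. pm_plus (V i) t (x i) (y i)),
     pm_scale = (\<lambda>t a x. \<lambda>i\<in>I. pm_scale (V i) t a (x i)),
     pm_trans = (\<lambda>s t x. \<lambda>i\<in>I. pm_trans (V i) s t (x i))\<rparr>"

definition filter_function :: "'a set set \<Rightarrow> ('a set \<Rightarrow> real) \<Rightarrow> bool" where
  "filter_function K f \<longleftrightarrow> (\<forall>\<sigma>\<in>K. \<forall>\<sigma>'\<in>K. \<sigma> \<subseteq> \<sigma>' \<longrightarrow> f \<sigma> \<le> f \<sigma>')"

definition sublevel :: "'a set set \<Rightarrow> ('a set \<Rightarrow> real) \<Rightarrow> real \<Rightarrow> 'a set set" where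
  "sublevel K f t = {\<sigma>\<in>K. f \<sigma> \<le> t}"

definition homology_module ::
  "'a set set \<Rightarrow> ('a set \<Rightarrow> real) \<Rightarrow> nat \<Rightarrow> ('k::field, ('a, 'k) chain set) persistence_module" where
  "homology_module K f p = \<lparr>
     pm_space = (\<lambda>t. homology (sublevel K f t) p),
     pm_plus = (\<lambda>t X Y. \<Union>x\<in>X. \<Union>y\<in>Y. homologous (sublevel K f t) p `` {\<lambda>xs. x xs + y xs}),
     pm_scale = (\<lambda>t a X. \<Union>x\<in>X. homologous (sublevel K f t) p `` {\<lambda>xs. a * x xs}),
     pm_trans = (\<lambda>s t X. \<Union>x\<in>X. homologous (sublevel K f t) p `` {x})\<rparr>"

text \<open>\<open>Inf\<close> on \<open>real\<close> is the infimum only for sets bounded below. This is no restriction, since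
  \<open>K\<^sup>t\<close> is empty for small \<open>t\<close>.\<close>

definition is_diagram ::
  "'k::field itself \<Rightarrow> 'a set set \<Rightarrow> nat \<Rightarrow> ('a set \<Rightarrow> real) \<Rightarrow> barcode \<Rightarrow> bool" where
  "is_diagram _ K p f D \<longleftrightarrow> (\<exists>N (J :: nat \<Rightarrow> real set).
     (\<forall>i<N. is_interval (J i) \<and> J i \<noteq> {} \<and> bdd_below (J i)) \<and>
     pm_isomorphic (homology_module K f p :: ('k, ('a, 'k) chain set) persistence_module)
       (pm_sum {..<N} (\<lambda>i. interval_module (J i))) \<and>
     D = with_diagonal (mset (map (\<lambda>i. (Inf (J i), SUP x\<in>J i. ereal x)) [0..<N])))"

text \<open>By the structure theorem, filter functions on finite complexes have exactly one diagram.
  The value in the other case is not an element of \<open>Bar\<close>.\<close>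

definition Dgm ::
  "'k::field itself \<Rightarrow> 'a set set \<Rightarrow> nat \<Rightarrow> ('a set \<Rightarrow> real) \<Rightarrow> barcode" where
  "Dgm k K p f =
     (if \<exists>!D. is_diagram k K p f D then (THE D. is_diagram k K p f D) else (\<lambda>_. 0))"

definition order_equiv :: "'a set set \<Rightarrow> ('a set \<Rightarrow> real) \<Rightarrow> ('a set \<Rightarrow> real) \<Rightarrow> bool" where
  "order_equiv K f g \<longleftrightarrow> (\<forall>\<sigma>\<in>K. \<forall>\<sigma>'\<in>K. f \<sigma> \<le> f \<sigma>' \<longleftrightarrow> g \<sigma> \<le> g \<sigma>')"

definition barcode_template ::
  "'k::field itself \<Rightarrow> 'a set set \<Rightarrow> nat \<Rightarrow> ('a set \<Rightarrow> real) \<Rightarrow>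
   ('a set \<times> 'a set) multiset \<Rightarrow> 'a set multiset \<Rightarrow> bool" where
  "barcode_template k K p f P U \<longleftrightarrow>
     set_mset P \<subseteq> K \<times> K \<and> set_mset U \<subseteq> K \<and>
     Dgm k K p f = with_diagonal
       (image_mset (\<lambda>(\<sigma>, \<sigma>'). (f \<sigma>, ereal (f \<sigma>'))) P + image_mset (\<lambda>\<sigma>. (f \<sigma>, \<infinity>)) U)"


section \<open>Smooth manifolds\<close>

text \<open>\<open>Ck_on k g S\<close>, for open \<open>S\<close>: \<open>g\<close> is of class \<open>C\<^sup>k\<close> on \<open>S\<close>, expressed through iterated directional
  derivatives. It is only used for finite-dimensional domains.\<close>

primrec Ck_on ::
  "nat \<Rightarrow> ('e::real_normed_vector \<Rightarrow> 'w::real_normed_vector) \<Rightarrow> 'e set \<Rightarrow> bool" where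
  "Ck_on 0 g S \<longleftrightarrow> continuous_on S g"
| "Ck_on (Suc k) g S \<longleftrightarrow>
     (\<forall>x\<in>S. g differentiable (at x)) \<and> (\<forall>v. Ck_on k (\<lambda>x. frechet_derivative g (at x) v) S)"

type_synonym ('m, 'e) chart = "'m set \<times> ('m \<Rightarrow> 'e)"

text \<open>The model space is a normed space rather than a \<open>euclidean_space\<close>, because the latter class
  excludes dimension \<open>0\<close>.\<close>

definition smooth_manifold ::
  "'m topology \<Rightarrow> ('m, 'e::real_normed_vector) chart set \<Rightarrow> bool" where
  "smooth_manifold M A \<longleftrightarrow>
     (\<exists>B :: 'e set. finite B \<and> span B = UNIV) \<and>
     Hausdorff_space M \<and> second_countable M \<and>
     (\<Union>(V, \<phi>)\<in>A. V) = topspace M \<and>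
     (\<forall>(V, \<phi>)\<in>A. openin M V \<and> open (\<phi> ` V) \<and>
        homeomorphic_map (subtopology M V) (top_of_set (\<phi> ` V)) \<phi>) \<and>
     (\<forall>(V, \<phi>)\<in>A. \<forall>(W, \<psi>)\<in>A. \<forall>k. Ck_on k (\<psi> \<circ> inv_into V \<phi>) (\<phi> ` (V \<inter> W)))"

definition C1_on ::
  "('m, 'e::real_normed_vector) chart set \<Rightarrow> 'm set \<Rightarrow> ('m \<Rightarrow> 'w::real_normed_vector) \<Rightarrow> bool" where
  "C1_on A W g \<longleftrightarrow> (\<forall>(V, \<phi>)\<in>A. Ck_on 1 (g \<circ> inv_into V \<phi>) (\<phi> ` (V \<inter> W)))"

definition charts_at :: "('m, 'e) chart set \<Rightarrow> 'm \<Rightarrow> ('m, 'e) chart set" where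
  "charts_at A \<theta> = {(V, \<phi>)\<in>A. \<theta> \<in> V}"

text \<open>A tangent vector at \<open>\<theta>\<close> assigns to each chart around \<open>\<theta>\<close> a coordinate vector, compatibly with
  the derivatives of the transition maps.\<close>

definition tangent_space ::
  "('m, 'e::real_normed_vector) chart set \<Rightarrow> 'm \<Rightarrow> (('m, 'e) chart \<Rightarrow> 'e) set" where
  "tangent_space A \<theta> = {v \<in> extensional (charts_at A \<theta>).
     \<forall>(V, \<phi>)\<in>charts_at A \<theta>. \<forall>(W, \<psi>)\<in>charts_at A \<theta>.
       v (W, \<psi>) = frechet_derivative (\<psi> \<circ> inv_into V \<phi>) (at (\<phi> \<theta>)) (v (V, \<phi>))}"

text \<open>On tangent vectors the value does not depend on the chosen chart.\<close>

definition differential ::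
  "('m, 'e::real_normed_vector) chart set \<Rightarrow> ('m \<Rightarrow> 'w::real_normed_vector) \<Rightarrow> 'm \<Rightarrow>
   (('m, 'e) chart \<Rightarrow> 'e) \<Rightarrow> 'w" where
  "differential A g \<theta> v =
     (let (V, \<phi>) = (SOME c. c \<in> charts_at A \<theta>)
      in frechet_derivative (g \<circ> inv_into V \<phi>) (at (\<phi> \<theta>)) (v (V, \<phi>)))"


section \<open>Local lifts of barcode-valued maps\<close>

definition local_C1_lift ::
  "'m topology \<Rightarrow> ('m, 'e::real_normed_vector) chart set \<Rightarrow> ('m \<Rightarrow> barcode) \<Rightarrow> 'm \<Rightarrow>
   nat \<Rightarrow> nat \<Rightarrow> ('m \<Rightarrow> (nat \<Rightarrow>\<^sub>0 real) \<times> (nat \<Rightarrow>\<^sub>0 real)) \<Rightarrow> bool" where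
  "local_C1_lift M A B \<theta> m n Bt \<longleftrightarrow> (\<exists>W. openin M W \<and> \<theta> \<in> W \<and>
     B \<in> W \<rightarrow> Bar \<and>
     Bt \<in> W \<rightarrow> coord_space {..<2 * m} \<times> coord_space {..<n} \<and>
     C1_on A W Bt \<and>
     (\<forall>\<theta>'\<in>W. B \<theta>' = Qmap m n (Bt \<theta>')))"

text \<open>The differential \<open>d\<^sub>\<theta>\<^sub>,\<^sub>B\<^sub>t B\<close> of \<open>B\<close> depends on the lift \<open>Bt\<close> only.\<close>

definition barcode_differential ::
  "('m, 'e::real_normed_vector) chart set \<Rightarrow> ('m \<Rightarrow> (nat \<Rightarrow>\<^sub>0 real) \<times> (nat \<Rightarrow>\<^sub>0 real)) \<Rightarrow> 'm \<Rightarrow>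
   (('m, 'e) chart \<Rightarrow> 'e) \<Rightarrow> (nat \<Rightarrow>\<^sub>0 real) \<times> (nat \<Rightarrow>\<^sub>0 real)" where
  "barcode_differential A Bt \<theta> = differential A Bt \<theta>"

definition order_stable_points ::
  "'m topology \<Rightarrow> 'a set set \<Rightarrow> ('m \<Rightarrow> ('a set \<Rightarrow>\<^sub>0 real)) \<Rightarrow> 'm set" where
  "order_stable_points M K F = {\<theta> \<in> topspace M. \<exists>V. openin M V \<and> \<theta> \<in> V \<and>
     (\<forall>\<theta>'\<in>V. order_equiv K (Poly_Mapping.lookup (F \<theta>')) (Poly_Mapping.lookup (F \<theta>)))}"

text \<open>For \<open>x\<close> in \<open>\<real>\<^sup>K\<close>, the vector \<open>[(x(\<sigma>\<^sub>i), x(\<sigma>'\<^sub>i))\<^sub>i, (x(\<tau>\<^sub>j))\<^sub>j]\<close> of \<open>\<real>\<^sup>2\<^sup>m \<times> \<real>\<^sup>n\<close>.\<close>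

definition template_coords ::
  "('a set \<times> 'a set) list \<Rightarrow> 'a set list \<Rightarrow> ('a set \<Rightarrow>\<^sub>0 real) \<Rightarrow>
   (nat \<Rightarrow>\<^sub>0 real) \<times> (nat \<Rightarrow>\<^sub>0 real)" where
  "template_coords ps ts x =
     (Poly_Mapping.nth (concat (map (\<lambda>(\<sigma>, \<sigma>'). [Poly_Mapping.lookup x \<sigma>, Poly_Mapping.lookup x \<sigma>']) ps)),
      Poly_Mapping.nth (map (Poly_Mapping.lookup x) ts))"

end

theory Submission
  imports Defs
begin

text \<open>
  Near an order-stable point \<open>\<theta>\<close> all filter functions induce the same preorder on the finite set \<open>K\<close>.
  If \<open>f\<close> and \<open>g\<close> induce the same preorder, then \<open>f \<sigma> \<mapsto> g \<sigma>\<close> is a well-defined strictly increasing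
  function on finitely many reals, and piecewise linear interpolation extends it to an increasing
  bijection \<open>\<phi>\<close> of the line (\<open>order_equiv_reparametrization\<close>). So \<open>g = \<phi> \<circ> f\<close> on \<open>K\<close>, and the sublevel
  filtration of \<open>g\<close> is that of \<open>f\<close> with the time axis relabelled by \<open>\<phi>\<close>. Relabelling time commutes with
  forming direct sums and turns the interval module of \<open>J\<close> into that of \<open>\<phi> ` J\<close>; an interval
  decomposition for \<open>f\<close> therefore becomes one for \<open>g\<close>, its endpoints being moved by \<open>\<phi>\<close>
  (\<open>is_diagram_reparametrize\<close>).

  Since \<open>\<phi>\<close> is invertible, this is a bijection between the diagrams of \<open>f\<close> and those of \<open>g\<close>, so that
  existence and uniqueness of the diagram pass from \<open>f\<close> to \<open>g\<close>. The existence of a template says that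
  \<open>Dgm f\<close> is a genuine diagram, as the default value in the definition of \<open>Dgm\<close> misses the diagonal.
  Because \<open>\<phi>\<close> moves \<open>f \<sigma>\<close> to \<open>g \<sigma>\<close>, a
  template of \<open>f\<close> is a template of \<open>g\<close> (\<open>barcode_template_order_equiv\<close>), which is the identity
  \<open>B = Q \<circ> Bt\<close> near \<open>\<theta>\<close>.

  The regularity of \<open>Bt\<close> and the formula for its differential hold because reading off the
  coordinates of a template is a bounded linear map, which commutes with differentiation.
\<close>

section \<open>Increasing bijections of the line\<close>

locale line_reparametrization =
  fixes \<phi> \<psi> :: "real \<Rightarrow> real"
  assumes mono_forward: "mono \<phi>" and mono_backward: "mono \<psi>"
    and forward_backward [simp]: "\<phi> (\<psi> x) = x" and backward_forward [simp]: "\<psi> (\<phi> x) = x"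
begin

lemma inverse_reparametrization: "line_reparametrization \<psi> \<phi>"
  by unfold_locales (auto intro: mono_forward mono_backward)

lemma forward_le_iff: "\<phi> x \<le> y \<longleftrightarrow> x \<le> \<psi> y"
  by (metis forward_backward backward_forward mono_backward mono_forward monoD)

lemma mem_image_forward_iff: "t \<in> \<phi> ` J \<longleftrightarrow> \<psi> t \<in> J"
  by (metis forward_backward backward_forward image_iff)

lemma inj_forward: "inj \<phi>"
  by (metis backward_forward injI)

lemma is_interval_image:
  assumes "is_interval J"
  shows "is_interval (\<phi> ` J)"
  unfolding is_interval_1
proof (intro ballI allI impI)
  fix a b x assume ab: "a \<in> \<phi> ` J" "b \<in> \<phi> ` J" "a \<le> x \<and> x \<le> b"
  have "\<psi> a \<le> \<psi> x" "\<psi> x \<le> \<psi> b"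
    using ab(3) mono_backward by (auto dest: monoD)
  then have "\<psi> x \<in> J"
    using assms ab(1,2) unfolding is_interval_1 mem_image_forward_iff by blast
  then show "x \<in> \<phi> ` J" by (simp add: mem_image_forward_iff)
qed

lemma bdd_below_image: "bdd_below J \<Longrightarrow> bdd_below (\<phi> ` J)"
  by (rule bdd_below_image_mono[OF mono_forward])

lemma Inf_image:
  assumes "J \<noteq> {}" "bdd_below J"
  shows "Inf (\<phi> ` J) = \<phi> (Inf J)"
proof (rule antisym)
  show "\<phi> (Inf J) \<le> Inf (\<phi> ` J)"
    using assms by (auto intro!: cInf_greatest monoD[OF mono_forward] cInf_lower)
  have "\<psi> (Inf (\<phi> ` J)) \<le> Inf J"
  proof (rule cInf_greatest[OF assms(1)])
    fix x assume "x \<in> J"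
    then have "Inf (\<phi> ` J) \<le> \<phi> x"
      by (intro cInf_lower bdd_below_image assms) auto
    then show "\<psi> (Inf (\<phi> ` J)) \<le> x"
      using mono_backward by (metis backward_forward monoD)
  qed
  then show "Inf (\<phi> ` J) \<le> \<phi> (Inf J)"
    by (metis forward_backward mono_forward monoD)
qed

end

definition ereal_extension :: "(real \<Rightarrow> real) \<Rightarrow> ereal \<Rightarrow> ereal" where
  "ereal_extension \<phi> x = (if \<bar>x\<bar> = \<infinity> then x else ereal (\<phi> (real_of_ereal x)))"

lemma ereal_extension_simps [simp]:
  "ereal_extension \<phi> (ereal r) = ereal (\<phi> r)"
  "ereal_extension \<phi> \<infinity> = \<infinity>"
  "ereal_extension \<phi> (-\<infinity>) = -\<infinity>"
  by (simp_all add: ereal_extension_def)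

lemma mono_ereal_extension:
  assumes "mono \<phi>" and "x \<le> y"
  shows "ereal_extension \<phi> x \<le> ereal_extension \<phi> y"
  using assms(2) monoD[OF assms(1)] by (cases x; cases y) auto

definition move_point :: "(real \<Rightarrow> real) \<Rightarrow> real \<times> ereal \<Rightarrow> real \<times> ereal" where
  "move_point \<phi> = map_prod \<phi> (ereal_extension \<phi>)"

lemma move_point_Pair [simp]: "move_point \<phi> (b, d) = (\<phi> b, ereal_extension \<phi> d)"
  by (simp add: move_point_def)

context line_reparametrization
begin

lemma ereal_extension_backward_forward [simp]:
  "ereal_extension \<psi> (ereal_extension \<phi> x) = x"
  by (cases x) auto

lemma ereal_extension_forward_backward [simp]:
  "ereal_extension \<phi> (ereal_extension \<psi> x) = x"
  by (cases x) auto

lemma move_point_backward_forward [simp]: "move_point \<psi> (move_point \<phi> x) = x"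
  by (cases x) simp

lemma move_point_forward_backward [simp]: "move_point \<phi> (move_point \<psi> x) = x"
  by (cases x) simp

lemma SUP_ereal_image:
  "(SUP x\<in>\<phi> ` J. ereal x) = ereal_extension \<phi> (SUP x\<in>J. ereal x)"
proof (rule antisym)
  show "(SUP x\<in>\<phi> ` J. ereal x) \<le> ereal_extension \<phi> (SUP x\<in>J. ereal x)"
  proof (rule SUP_least, clarify)
    fix x assume "x \<in> J"
    then have "ereal_extension \<phi> (ereal x) \<le> ereal_extension \<phi> (SUP x\<in>J. ereal x)"
      by (intro mono_ereal_extension mono_forward SUP_upper)
    then show "ereal (\<phi> x) \<le> ereal_extension \<phi> (SUP x\<in>J. ereal x)" by simp
  qed
  have "(SUP x\<in>J. ereal x) \<le> ereal_extension \<psi> (SUP x\<in>\<phi> ` J. ereal x)"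
  proof (rule SUP_least)
    fix x assume "x \<in> J"
    then have "ereal_extension \<psi> (ereal (\<phi> x)) \<le> ereal_extension \<psi> (SUP x\<in>\<phi> ` J. ereal x)"
      by (intro mono_ereal_extension mono_backward SUP_upper) auto
    then show "ereal x \<le> ereal_extension \<psi> (SUP x\<in>\<phi> ` J. ereal x)" by simp
  qed
  from mono_ereal_extension[OF mono_forward this]
  show "ereal_extension \<phi> (SUP x\<in>J. ereal x) \<le> (SUP x\<in>\<phi> ` J. ereal x)" by simp
qed

lemma count_image_mset_move:
  "count (image_mset (move_point \<phi>) D) (move_point \<phi> x) = count D x"
proof (induction D)
  case (add y D)
  have "move_point \<phi> y = move_point \<phi> x \<longleftrightarrow> y = x"
    by (metis move_point_backward_forward)
  then show ?case using add.IH by simp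
qed simp

text \<open>A multiplicity function is pushed forward along \<open>\<phi>\<close> by composing it with the inverse. The
  infinitely many diagonal points cause no trouble, since \<open>\<phi>\<close> moves both coordinates alike and so
  permutes the diagonal.\<close>

lemma with_diagonal_move:
  "with_diagonal (image_mset (move_point \<phi>) D) = with_diagonal D \<circ> move_point \<psi>"
proof
  fix y
  define x where "x = move_point \<psi> y"
  have y: "y = move_point \<phi> x" by (simp add: x_def)
  have "count (image_mset (move_point \<phi>) D) y = count D x"
    unfolding y by (rule count_image_mset_move)
  moreover have "snd y = ereal (fst y) \<longleftrightarrow> snd x = ereal (fst x)"
    unfolding y
    by (cases x; cases "snd x") (auto dest: injD[OF inj_forward])
  ultimately show "with_diagonal (image_mset (move_point \<phi>) D) y = (with_diagonal D \<circ> move_point \<psi>) y"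
    by (simp add: with_diagonal_def flip: x_def)
qed

end

text \<open>Extending one point at a time in increasing order, each extension keeps the function up to the
  last point and continues it along the line through the last two values.\<close>

lemma strict_mono_on_finite_extends:
  fixes h :: "real \<Rightarrow> real"
  assumes "finite S" and "strict_mono_on S h"
  shows "\<exists>\<phi>. strict_mono \<phi> \<and> surj \<phi> \<and> (\<forall>x\<in>S. \<phi> x = h x)"
  using assms
proof (induction S rule: finite_linorder_max_induct)
  case empty
  have "strict_mono (id :: real \<Rightarrow> real)" by (simp add: strict_mono_def)
  then show ?case by (metis empty_iff surj_id)
next
  case (insert b S)
  show ?case
  proof (cases "S = {}")
    case True
    define \<phi> where "\<phi> x = x + (h b - b)" for x
    have "\<phi> (y - (h b - b)) = y" for y by (simp add: \<phi>_def)
    then have "surj \<phi>" unfolding surj_def by metis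
    moreover have "strict_mono \<phi>" by (simp add: \<phi>_def strict_mono_def)
    moreover have \<phi>_at_b: "\<phi> b = h b" by (simp add: \<phi>_def)
    ultimately show ?thesis using True by (metis \<phi>_at_b emptyE insertE)
  next
    case False
    obtain \<phi> where \<phi>: "strict_mono \<phi>" "surj \<phi>" "\<forall>x\<in>S. \<phi> x = h x"
      using insert.IH insert.prems by (auto simp: strict_mono_on_def)
    define a where "a = Max S"
    have aS: "a \<in> S" using False insert.hyps(1) by (simp add: a_def)
    have a_max: "x \<le> a" if "x \<in> S" for x using that insert.hyps(1) by (simp add: a_def)
    have "a < b" using aS insert.hyps(2) by blast
    then have "h a < h b" using insert.prems aS by (auto simp: strict_mono_on_def)
    define c where "c = (h b - h a) / (b - a)"
    have "c > 0" using \<open>a < b\<close> \<open>h a < h b\<close> by (simp add: c_def)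
    define \<phi>' where "\<phi>' x = (if x \<le> a then \<phi> x else h a + c * (x - a))" for x
    have \<phi>a: "\<phi> a = h a" using \<phi>(3) aS by blast
    have "strict_mono \<phi>'"
    proof (rule strict_monoI)
      fix x y :: real assume "x < y"
      show "\<phi>' x < \<phi>' y"
      proof (cases "a < y")
        case True
        then have \<phi>'y: "\<phi>' y = h a + c * (y - a)" by (simp add: \<phi>'_def)
        show ?thesis
        proof (cases "x \<le> a")
          case True
          then have "\<phi> x \<le> h a"
            unfolding \<phi>a[symmetric] strict_mono_less_eq[OF \<phi>(1)] .
          then have "\<phi>' x \<le> h a" using \<open>x \<le> a\<close> by (simp add: \<phi>'_def)
          moreover have "0 < c * (y - a)" using \<open>a < y\<close> \<open>c > 0\<close> by simp
          ultimately show ?thesis unfolding \<phi>'y by linarith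
        next
          case False
          then show ?thesis using \<open>c > 0\<close> \<open>x < y\<close> by (simp add: \<phi>'y \<phi>'_def)
        qed
      next
        case False
        then show ?thesis using \<phi>(1) \<open>x < y\<close> by (auto simp: \<phi>'_def strict_mono_def)
      qed
    qed
    moreover have "\<exists>x. \<phi>' x = y" for y
    proof (cases "y \<le> h a")
      case True
      obtain x where "\<phi> x = y" using \<phi>(2) by (metis surjD)
      then have "\<phi> x \<le> \<phi> a" using True \<phi>a by simp
      then have "x \<le> a" unfolding strict_mono_less_eq[OF \<phi>(1)] .
      then show ?thesis using \<open>\<phi> x = y\<close> by (auto simp: \<phi>'_def)
    next
      case False
      then have "(y - h a) / c > 0" using \<open>c > 0\<close> by simp
      then have "\<phi>' (a + (y - h a) / c) = y" using \<open>c > 0\<close> by (simp add: \<phi>'_def)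
      then show ?thesis by blast
    qed
    moreover have "\<phi>' x = h x" if "x \<in> insert b S" for x
      using that \<open>a < b\<close> a_max \<phi>(3) by (auto simp: \<phi>'_def c_def)
    ultimately show ?thesis by (intro exI[of _ \<phi>']) (simp add: surj_def, metis)
  qed
qed

lemma order_equiv_reparametrization:
  assumes "finite K" and fg: "order_equiv K f g"
  shows "\<exists>\<phi> \<psi>. line_reparametrization \<phi> \<psi> \<and> (\<forall>\<sigma>\<in>K. g \<sigma> = \<phi> (f \<sigma>))"
proof -
  \<comment> \<open>Simplices with equal \<open>f\<close>-values have equal \<open>g\<close>-values, so any right inverse of \<open>f\<close> does.\<close>
  define h where "h = g \<circ> inv_into K f"
  have h: "h (f \<sigma>) = g \<sigma>" if "\<sigma> \<in> K" for \<sigma>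
  proof -
    define \<tau> where "\<tau> = inv_into K f (f \<sigma>)"
    have "\<tau> \<in> K" "f \<tau> = f \<sigma>"
      using that by (auto simp: \<tau>_def inv_into_into f_inv_into_f)
    then have "g \<tau> = g \<sigma>"
      using fg that unfolding order_equiv_def by (metis order.eq_iff)
    then show ?thesis by (simp add: h_def \<tau>_def)
  qed
  have "strict_mono_on (f ` K) h"
    using fg by (auto simp: strict_mono_on_def h order_equiv_def simp flip: not_le)
  then obtain \<phi> where \<phi>: "strict_mono \<phi>" "surj \<phi>" "\<forall>x\<in>f ` K. \<phi> x = h x"
    using strict_mono_on_finite_extends[OF finite_imageI[OF \<open>finite K\<close>]] by metis
  have "inj \<phi>" using \<phi>(1) by (rule strict_mono_imp_inj_on)
  have "mono (inv \<phi>)"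
    using \<phi>(1,2) by (intro monoI) (metis strict_mono_less_eq surj_f_inv_f)
  then have "line_reparametrization \<phi> (inv \<phi>)"
    using \<phi>(1,2) \<open>inj \<phi>\<close> by unfold_locales (auto simp: strict_mono_mono surj_f_inv_f)
  then show ?thesis using \<phi>(3) h by (intro exI[of _ \<phi>] exI[of _ "inv \<phi>"]) auto
qed

section \<open>Relabelling the time axis of a persistence module\<close>

definition retime ::
  "(real \<Rightarrow> real) \<Rightarrow> ('k, 'v) persistence_module \<Rightarrow> ('k, 'v) persistence_module" where
  "retime \<psi> V = \<lparr>
     pm_space = (\<lambda>t. pm_space V (\<psi> t)),
     pm_plus = (\<lambda>t. pm_plus V (\<psi> t)),
     pm_scale = (\<lambda>t. pm_scale V (\<psi> t)),
     pm_trans = (\<lambda>s t. pm_trans V (\<psi> s) (\<psi> t))\<rparr>"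

lemma pm_isomorphic_retime:
  assumes "pm_isomorphic V W" and "mono \<psi>"
  shows "pm_isomorphic (retime \<psi> V) (retime \<psi> W)"
proof -
  obtain \<Phi> where
    "\<forall>t. bij_betw (\<Phi> t) (pm_space V t) (pm_space W t)"
    "\<forall>t. \<forall>x\<in>pm_space V t. \<forall>y\<in>pm_space V t.
        \<Phi> t (pm_plus V t x y) = pm_plus W t (\<Phi> t x) (\<Phi> t y)"
    "\<forall>t a. \<forall>x\<in>pm_space V t. \<Phi> t (pm_scale V t a x) = pm_scale W t a (\<Phi> t x)"
    "\<forall>s t. s \<le> t \<longrightarrow> (\<forall>x\<in>pm_space V s. \<Phi> t (pm_trans V s t x) = pm_trans W s t (\<Phi> s x))"
    using assms(1) unfolding pm_isomorphic_def by blast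
  then show ?thesis
    unfolding pm_isomorphic_def
    by (intro exI[of _ "\<lambda>t. \<Phi> (\<psi> t)"]) (simp add: retime_def monoD[OF assms(2)])
qed

lemma retime_pm_sum: "retime \<psi> (pm_sum I V) = pm_sum I (\<lambda>i. retime \<psi> (V i))"
  by (simp add: retime_def pm_sum_def)

context line_reparametrization
begin

lemma retime_interval_module:
  "retime \<psi> (interval_module J) = (interval_module (\<phi> ` J) :: ('k::field, 'k) persistence_module)"
  by (simp add: retime_def interval_module_def mem_image_forward_iff)

lemma retime_homology_module:
  assumes "\<And>\<sigma>. \<sigma> \<in> K \<Longrightarrow> g \<sigma> = \<phi> (f \<sigma>)"
  shows "retime \<psi> (homology_module K f p) =
    (homology_module K g p :: ('k::field, ('a, 'k) chain set) persistence_module)"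
proof -
  have "sublevel K g t = sublevel K f (\<psi> t)" for t
    using assms by (auto simp: sublevel_def forward_le_iff)
  then show ?thesis by (simp add: retime_def homology_module_def)
qed

text \<open>The interval modules of a decomposition are carried to interval modules over the image
  intervals, and an increasing bijection commutes with infima and suprema.\<close>

lemma is_diagram_reparametrize:
  assumes D: "is_diagram (k :: 'k::field itself) K p f D"
    and fg: "\<And>\<sigma>. \<sigma> \<in> K \<Longrightarrow> g \<sigma> = \<phi> (f \<sigma>)"
  shows "is_diagram k K p g (D \<circ> move_point \<psi>)"
proof -
  obtain N J where J: "\<And>i. i < N \<Longrightarrow> is_interval (J i) \<and> J i \<noteq> {} \<and> bdd_below (J i)"
    and iso: "pm_isomorphic (homology_module K f p :: ('k, ('a, 'k) chain set) persistence_module)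
       (pm_sum {..<N} (\<lambda>i. interval_module (J i)))"
    and D_eq: "D = with_diagonal (mset (map (\<lambda>i. (Inf (J i), SUP x\<in>J i. ereal x)) [0..<N]))"
    using D unfolding is_diagram_def by auto
  have "pm_isomorphic (homology_module K g p :: ('k, ('a, 'k) chain set) persistence_module)
       (pm_sum {..<N} (\<lambda>i. interval_module (\<phi> ` J i)))"
    using pm_isomorphic_retime[OF iso mono_backward]
    by (simp only: retime_homology_module[OF fg] retime_pm_sum retime_interval_module)
  moreover have "\<forall>i<N. is_interval (\<phi> ` J i) \<and> \<phi> ` J i \<noteq> {} \<and> bdd_below (\<phi> ` J i)"
    using J by (simp add: is_interval_image bdd_below_image)
  moreover have "D \<circ> move_point \<psi> =
    with_diagonal (mset (map (\<lambda>i. (Inf (\<phi> ` J i), SUP x\<in>\<phi> ` J i. ereal x)) [0..<N]))"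
  proof -
    have "map (\<lambda>i. (Inf (\<phi> ` J i), SUP x\<in>\<phi> ` J i. ereal x)) [0..<N] =
      map (move_point \<phi>) (map (\<lambda>i. (Inf (J i), SUP x\<in>J i. ereal x)) [0..<N])"
      unfolding map_map
      by (rule map_cong) (simp_all only: comp_apply move_point_Pair SUP_ereal_image, simp_all add: J Inf_image)
    then show ?thesis
      unfolding D_eq with_diagonal_move[symmetric] by (simp only: mset_map)
  qed
  ultimately show ?thesis unfolding is_diagram_def by (intro exI conjI)
qed

text \<open>Transport along \<open>\<psi>\<close> sends any diagram of \<open>g\<close> back to one of \<open>f\<close>, so \<open>g\<close> cannot have more
  diagrams than \<open>f\<close>.\<close>

lemma Dgm_reparametrize:
  assumes ex1: "\<exists>!D. is_diagram (k :: 'k::field itself) K p f D"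
    and fg: "\<And>\<sigma>. \<sigma> \<in> K \<Longrightarrow> g \<sigma> = \<phi> (f \<sigma>)"
  shows "Dgm k K p g = Dgm k K p f \<circ> move_point \<psi>"
proof -
  have f_diagram: "is_diagram k K p f (Dgm k K p f)"
    using theI'[OF ex1] ex1 by (simp add: Dgm_def)
  have g_diagram: "is_diagram k K p g (Dgm k K p f \<circ> move_point \<psi>)"
    using f_diagram fg by (rule is_diagram_reparametrize)
  have unique: "D = Dgm k K p f \<circ> move_point \<psi>" if "is_diagram k K p g D" for D
  proof -
    interpret inverse: line_reparametrization \<psi> \<phi> by (rule inverse_reparametrization)
    have "is_diagram k K p f (D \<circ> move_point \<phi>)"
      using that by (rule inverse.is_diagram_reparametrize) (simp add: fg)
    then have "D \<circ> move_point \<phi> = Dgm k K p f" using f_diagram ex1 by blast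
    moreover have "D = (D \<circ> move_point \<phi>) \<circ> move_point \<psi>"
      unfolding fun_eq_iff comp_apply move_point_forward_backward by (rule allI refl)+
    ultimately show ?thesis by simp
  qed
  then show ?thesis
    using g_diagram unfolding Dgm_def[of k K p g]
    by (metis (no_types, lifting) the_equality)
qed

end

section \<open>Templates\<close>

definition template_points ::
  "('a set \<Rightarrow> real) \<Rightarrow> ('a set \<times> 'a set) multiset \<Rightarrow> 'a set multiset \<Rightarrow> (real \<times> ereal) multiset" where
  "template_points f P U =
     image_mset (\<lambda>(\<sigma>, \<sigma>'). (f \<sigma>, ereal (f \<sigma>'))) P + image_mset (\<lambda>\<sigma>. (f \<sigma>, \<infinity>)) U"

text \<open>A barcode has infinite multiplicity on the diagonal, so it is never the default value of \<open>Dgm\<close>.\<close>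

lemma barcode_template_ex1_diagram:
  assumes "barcode_template k K p f P U"
  shows "\<exists>!D. is_diagram k K p f D"
proof (rule ccontr)
  assume "\<not> ?thesis"
  then have "Dgm k K p f = (\<lambda>_. 0)" by (simp only: Dgm_def if_False)
  then have "with_diagonal (template_points f P U) (0, ereal 0) = 0"
    using assms unfolding barcode_template_def template_points_def by metis
  then show False by (simp add: with_diagonal_def)
qed

lemma barcode_template_order_equiv:
  assumes "finite K" and fg: "order_equiv K f g" and templ: "barcode_template k K p f P U"
  shows "barcode_template k K p g P U"
proof -
  obtain \<phi> \<psi> where "line_reparametrization \<phi> \<psi>" and g: "\<And>\<sigma>. \<sigma> \<in> K \<Longrightarrow> g \<sigma> = \<phi> (f \<sigma>)"
    using order_equiv_reparametrization[OF \<open>finite K\<close> fg] by blast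
  then interpret line_reparametrization \<phi> \<psi> by simp
  have PU: "set_mset P \<subseteq> K \<times> K" "set_mset U \<subseteq> K"
    and Dgm_f: "Dgm k K p f = with_diagonal (template_points f P U)"
    using templ by (simp_all add: barcode_template_def template_points_def)
  have "image_mset (move_point \<phi>) (template_points f P U) = template_points g P U"
    using PU by (auto simp: template_points_def multiset.map_comp comp_def g
        intro!: arg_cong2[where f = "(+)"] image_mset_cong)
  then have "Dgm k K p g = with_diagonal (template_points g P U)"
    using Dgm_reparametrize[OF barcode_template_ex1_diagram[OF templ] g] Dgm_f
    by (simp flip: with_diagonal_move)
  then show ?thesis using PU by (simp add: barcode_template_def template_points_def)
qed

lemma with_diagonal_template_points_in_Bar: "with_diagonal (template_points f P U) \<in> Bar"
proof -
  have "\<forall>x\<in>#template_points f P U. snd x \<noteq> -\<infinity>" by (auto simp: template_points_def)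
  then show ?thesis unfolding Bar_def by blast
qed

lemma nth_default_concat_pairs:
  assumes "i < length xs"
  shows "nth_default z (concat (map (\<lambda>(a, b). [F a, F b]) xs)) (2 * i) = F (fst (xs ! i))"
    and "nth_default z (concat (map (\<lambda>(a, b). [F a, F b]) xs)) (2 * i + 1) = F (snd (xs ! i))"
  using assms
proof (induction xs arbitrary: i)
  case (Cons x xs)
  { case 1 then show ?case using Cons.IH(1) by (cases i; cases x) auto }
  { case 2 then show ?case using Cons.IH(2) by (cases i; cases x) auto }
qed auto

lemma Qmap_template_coords:
  "Qmap (length ps) (length ts) (template_coords ps ts x) =
     with_diagonal (template_points (Poly_Mapping.lookup x) (mset ps) (mset ts))"
proof -
  let ?f = "Poly_Mapping.lookup x" and ?z = "template_coords ps ts x"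
  have "map (\<lambda>i. (Poly_Mapping.lookup (fst ?z) (2 * i),
                 ereal (Poly_Mapping.lookup (fst ?z) (2 * i + 1)))) [0..<length ps]
      = map (\<lambda>(\<sigma>, \<sigma>'). (?f \<sigma>, ereal (?f \<sigma>'))) ps"
    using nth_default_concat_pairs[where F = ?f and xs = ps]
    by (intro nth_equalityI) (auto simp: template_coords_def split_beta)
  moreover have "map (\<lambda>j. (Poly_Mapping.lookup (snd ?z) j, \<infinity>)) [0..<length ts]
      = map (\<lambda>\<tau>. (?f \<tau>, \<infinity> :: ereal)) ts"
    by (intro nth_equalityI) (auto simp: template_coords_def nth_default_def)
  ultimately show ?thesis unfolding Qmap_def template_points_def by simp
qed

section \<open>Regularity of the lift\<close>

definition pick_coords :: "'b list \<Rightarrow> ('b \<Rightarrow>\<^sub>0 real) \<Rightarrow> (nat \<Rightarrow>\<^sub>0 real)" where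
  "pick_coords js x = Poly_Mapping.nth (map (Poly_Mapping.lookup x) js)"

lemma template_coords_eq_pick_coords:
  "template_coords ps ts x =
     (pick_coords (concat (map (\<lambda>(\<sigma>, \<sigma>'). [\<sigma>, \<sigma>']) ps)) x, pick_coords ts x)"
  by (simp add: template_coords_def pick_coords_def map_concat case_prod_unfold comp_def)

lemma lookup_pick_coords:
  "Poly_Mapping.lookup (pick_coords js x) n =
     (if n < length js then Poly_Mapping.lookup x (js ! n) else 0)"
  by (simp add: pick_coords_def nth_default_def)

lemma keys_pick_coords: "Poly_Mapping.keys (pick_coords js x) \<subseteq> {..<length js}"
  by (auto simp: in_keys_iff lookup_pick_coords split: if_splits simp del: keys_nth)

lemma norm_poly_mapping_eq_sum:
  "norm x = (\<Sum>n\<in>Poly_Mapping.keys x. norm (Poly_Mapping.lookup x n))"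
  by (simp add: norm_poly_mapping_def dist_poly_mapping_def)

lemma norm_lookup_le: "norm (Poly_Mapping.lookup x n) \<le> norm x"
  unfolding norm_poly_mapping_eq_sum
  by (cases "n \<in> Poly_Mapping.keys x") (auto intro: member_le_sum sum_nonneg simp: in_keys_iff)

lemma bounded_linear_pick_coords: "bounded_linear (pick_coords js)"
proof
  show "pick_coords js (x + y) = pick_coords js x + pick_coords js y" for x y
    by (rule poly_mapping_eqI) (simp add: lookup_pick_coords lookup_add)
  show "pick_coords js (r *\<^sub>R x) = r *\<^sub>R pick_coords js x" for r x
    by (rule poly_mapping_eqI) (simp add: lookup_pick_coords scaleR_poly_mapping_def)
  have "norm (pick_coords js x) \<le> norm x * real (length js)" for x
  proof -
    have "norm (pick_coords js x)
        \<le> (\<Sum>n<length js. norm (Poly_Mapping.lookup (pick_coords js x) n))"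
      unfolding norm_poly_mapping_eq_sum by (intro sum_mono2 keys_pick_coords) auto
    also have "\<dots> \<le> (\<Sum>n<length js. norm x)"
      by (intro sum_mono) (simp add: lookup_pick_coords norm_lookup_le del: real_norm_def)
    finally show ?thesis by (simp add: mult.commute)
  qed
  then show "\<exists>C. \<forall>x. norm (pick_coords js x) \<le> norm x * C" by blast
qed

lemma bounded_linear_template_coords: "bounded_linear (template_coords ps ts)"
  using bounded_linear_Pair[OF bounded_linear_pick_coords bounded_linear_pick_coords]
  by (simp add: template_coords_eq_pick_coords[abs_def])

lemma template_coords_in_coord_space:
  "template_coords ps ts x \<in> coord_space {..<2 * length ps} \<times> coord_space {..<length ts}"
proof -
  have "length (concat (map (\<lambda>(\<sigma>, \<sigma>'). [\<sigma>, \<sigma>']) ps)) = 2 * length ps"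
    by (induction ps) auto
  then show ?thesis
    using keys_pick_coords[of "concat (map (\<lambda>(\<sigma>, \<sigma>'). [\<sigma>, \<sigma>']) ps)" x] keys_pick_coords[of ts x]
    by (simp add: template_coords_eq_pick_coords coord_space_def)
qed

lemma frechet_derivative_bounded_linear_comp:
  assumes "bounded_linear T" and "h differentiable (at x)"
  shows "(T \<circ> h) differentiable (at x)"
    and "frechet_derivative (T \<circ> h) (at x) v = T (frechet_derivative h (at x) v)"
proof -
  have "((\<lambda>y. T (h y)) has_derivative (\<lambda>v. T (frechet_derivative h (at x) v))) (at x)"
    using assms(2) unfolding frechet_derivative_works
    by (rule bounded_linear.has_derivative[OF assms(1)])
  then have "((T \<circ> h) has_derivative (\<lambda>v. T (frechet_derivative h (at x) v))) (at x)"
    by (simp add: comp_def)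
  from frechet_derivative_at[OF this] this
  show "(T \<circ> h) differentiable (at x)"
    and "frechet_derivative (T \<circ> h) (at x) v = T (frechet_derivative h (at x) v)"
    by (auto simp: differentiable_def fun_eq_iff)
qed

lemma Ck_on_1_bounded_linear_comp:
  assumes T: "bounded_linear T" and h: "Ck_on 1 h S"
  shows "Ck_on 1 (T \<circ> h) S"
proof -
  have diff: "\<forall>x\<in>S. h differentiable (at x)"
    and cont: "\<And>v. continuous_on S (\<lambda>x. frechet_derivative h (at x) v)"
    using h by simp_all
  have "continuous_on S (\<lambda>x. frechet_derivative (T \<circ> h) (at x) v)" for v
    using bounded_linear.continuous_on[OF T cont[of v]]
    by (rule continuous_on_eq) (use diff in \<open>simp add: frechet_derivative_bounded_linear_comp[OF T]\<close>)
  then show ?thesis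
    using diff by (simp add: frechet_derivative_bounded_linear_comp(1)[OF T])
qed

lemma Ck_on_1_subset: "Ck_on 1 h S \<Longrightarrow> S' \<subseteq> S \<Longrightarrow> Ck_on 1 h S'"
  unfolding One_nat_def Ck_on.simps by (meson continuous_on_subset subsetD)

lemma C1_on_subset:
  assumes "C1_on A W g" and "W' \<subseteq> W"
  shows "C1_on A W' g"
  unfolding C1_on_def
proof clarify
  fix V \<phi> assume "(V, \<phi>) \<in> A"
  then have "Ck_on 1 (g \<circ> inv_into V \<phi>) (\<phi> ` (V \<inter> W))"
    using assms(1) unfolding C1_on_def by blast
  then show "Ck_on 1 (g \<circ> inv_into V \<phi>) (\<phi> ` (V \<inter> W'))"
    by (rule Ck_on_1_subset) (use assms(2) in blast)
qed

lemma C1_on_bounded_linear_comp: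
  assumes "bounded_linear T" and "C1_on A W g"
  shows "C1_on A W (\<lambda>x. T (g x))"
  unfolding C1_on_def
proof clarify
  fix V \<phi> assume "(V, \<phi>) \<in> A"
  then have "Ck_on 1 (g \<circ> inv_into V \<phi>) (\<phi> ` (V \<inter> W))"
    using assms(2) unfolding C1_on_def by blast
  from Ck_on_1_bounded_linear_comp[OF assms(1) this]
  show "Ck_on 1 ((\<lambda>x. T (g x)) \<circ> inv_into V \<phi>) (\<phi> ` (V \<inter> W))"
    by (simp only: comp_def)
qed

lemma differential_bounded_linear_comp:
  assumes T: "bounded_linear T" and g: "C1_on A W g" and \<theta>: "\<theta> \<in> W" "charts_at A \<theta> \<noteq> {}"
  shows "differential A (\<lambda>x. T (g x)) \<theta> v = T (differential A g \<theta> v)"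
proof -
  obtain V \<phi> where c: "(SOME c. c \<in> charts_at A \<theta>) = (V, \<phi>)" by fastforce
  then have "(V, \<phi>) \<in> charts_at A \<theta>" using \<theta>(2) by (metis some_in_eq)
  then have "(V, \<phi>) \<in> A" "\<phi> \<theta> \<in> \<phi> ` (V \<inter> W)"
    using \<theta>(1) by (auto simp: charts_at_def)
  then have "(g \<circ> inv_into V \<phi>) differentiable (at (\<phi> \<theta>))"
    using g unfolding C1_on_def by auto
  from frechet_derivative_bounded_linear_comp(2)[OF T this]
  show ?thesis by (simp add: differential_def c comp_def)
qed

section \<open>Lifting the barcode map\<close>

theorem proposition4p14:
  fixes K :: "'a set set" and p :: nat
    and M :: "'m topology" and A :: "('m, 'e::real_normed_vector) chart set"
    and F :: "'m \<Rightarrow> ('a set \<Rightarrow>\<^sub>0 real)" and U :: "'m set" and \<theta> :: 'm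
    and P\<^sub>p :: "('a set \<times> 'a set) multiset" and U\<^sub>p :: "'a set multiset"
    and ps :: "('a set \<times> 'a set) list" and ts :: "'a set list"
  assumes "finite K" and "abstract_simplicial_complex K"
    and "smooth_manifold M A"
    and "F \<in> topspace M \<rightarrow> coord_space K" and "continuous_map M euclidean F"
    and "\<And>\<theta>'. \<theta>' \<in> topspace M \<Longrightarrow> filter_function K (Poly_Mapping.lookup (F \<theta>'))"
    and "openin M U" and "C1_on A U F"
    and "\<theta> \<in> U \<inter> order_stable_points M K F"
    and "barcode_template TYPE('k::field) K p (Poly_Mapping.lookup (F \<theta>)) P\<^sub>p U\<^sub>p"
    and "mset ps = P\<^sub>p" and "mset ts = U\<^sub>p"
  shows "let B = (\<lambda>\<theta>'. Dgm TYPE('k) K p (Poly_Mapping.lookup (F \<theta>')));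
             Bt = (\<lambda>\<theta>'. template_coords ps ts (F \<theta>'))
         in local_C1_lift M A B \<theta> (length ps) (length ts) Bt \<and>
            (\<forall>v\<in>tangent_space A \<theta>.
               barcode_differential A Bt \<theta> v = template_coords ps ts (differential A F \<theta> v))"
proof -
  let ?f = "\<lambda>\<theta>'. Poly_Mapping.lookup (F \<theta>')"
  let ?B = "\<lambda>\<theta>'. Dgm TYPE('k) K p (?f \<theta>')"
  let ?Bt = "\<lambda>\<theta>'. template_coords ps ts (F \<theta>')"
  obtain V where V: "openin M V" "\<theta> \<in> V" "\<And>\<theta>'. \<theta>' \<in> V \<Longrightarrow> order_equiv K (?f \<theta>') (?f \<theta>)"
    using assms(9) by (auto simp: order_stable_points_def)
  define W where "W = U \<inter> V"
  have W: "openin M W" "\<theta> \<in> W" "W \<subseteq> U"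
    using V assms(7,9) by (auto simp: W_def)
  have B: "?B \<theta>' = with_diagonal (template_points (?f \<theta>') (mset ps) (mset ts))" if "\<theta>' \<in> W" for \<theta>'
  proof -
    have "order_equiv K (?f \<theta>) (?f \<theta>')"
      using V(3)[of \<theta>'] that by (auto simp: W_def order_equiv_def)
    then have "barcode_template TYPE('k) K p (?f \<theta>') P\<^sub>p U\<^sub>p"
      by (rule barcode_template_order_equiv[OF assms(1) _ assms(10)])
    then show ?thesis by (simp add: barcode_template_def template_points_def assms(11,12))
  qed
  have "local_C1_lift M A ?B \<theta> (length ps) (length ts) ?Bt"
    unfolding local_C1_lift_def
  proof (intro exI[of _ W] conjI ballI)
    show "?B \<in> W \<rightarrow> Bar" by (auto simp: B with_diagonal_template_points_in_Bar)
    show "?Bt \<in> W \<rightarrow> coord_space {..<2 * length ps} \<times> coord_space {..<length ts}"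
      using template_coords_in_coord_space by blast
    show "C1_on A W ?Bt"
      using bounded_linear_template_coords C1_on_subset[OF assms(8) W(3)]
      by (rule C1_on_bounded_linear_comp)
    show "?B \<theta>' = Qmap (length ps) (length ts) (?Bt \<theta>')" if "\<theta>' \<in> W" for \<theta>'
      using B[OF that] by (simp add: Qmap_template_coords)
  qed (use W in auto)
  moreover have "barcode_differential A ?Bt \<theta> v = template_coords ps ts (differential A F \<theta> v)" for v
  proof -
    have "\<theta> \<in> \<Union> ((\<lambda>(V, \<phi>). V) ` A)"
      using assms(3,9) by (auto simp: smooth_manifold_def order_stable_points_def)
    then have "charts_at A \<theta> \<noteq> {}" by (auto simp: charts_at_def)
    then show ?thesis
      unfolding barcode_differential_def
      using assms(9)
      by (intro differential_bounded_linear_comp[OF bounded_linear_template_coords assms(8)]) auto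
  qed
  ultimately show ?thesis by (simp add: Let_def)
qed

end
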